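(* Let $m\ge 1$ be an integer and let $q_j$ ($j\ge 0$) be the denominators of the convergents of $\sqrt{m^2+2}=[m;\overline{m,2m}]$, so $q_0=1$, $q_1=m$; put also $q_{-1}=0$. Let $M=2(m^2+1)$. Then for all $k\ge 1$, $$q_{2k+2}=Mq_{2k}-q_{2k-2},\qquad q_{2k+1}=Mq_{2k-1}-q_{2k-3},$$ so that $q_2=2m^2+1$, $q_3=2m(m^2+1)$, $q_4=2m^2(2m^2+3)+1$; and for all integers $k\ge 1$ and $n\ge 1$, $$\sqrt{(q_{2k}n+m)^2+2(2q_{2k-1}n+1)}=\left[q_{2k}n+m;\ \overline{\underbrace{m,2m,\dots,m,2m}_{(m,2m)\text{ repeated }k\text{ times}},\ q_{2k}n+m,\ \underbrace{2m,m,\dots,2m,m}_{(2m,m)\text{ repeated }k\text{ times}},\ 2(q_{2k}n+m)}\right].$$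
   Context: $[a_0;\overline{a_1,\dots,a_\ell}]$ denotes the value of the infinite simple continued fraction $a_0+\cfrac{1}{a_1+\cfrac{1}{a_2+\dotsb}}$ with first partial quotient $a_0$, after which the block $a_1,\dots,a_\ell$ of positive integers is repeated indefinitely. For a continued fraction $[a_0;a_1,a_2,\dots]$ the denominators of the convergents are given by $q_{-2}=1$, $q_{-1}=0$, $q_j=a_jq_{j-1}+q_{j-2}$ for $j\ge 0$. *)

theory Defs
  imports Complex_Main
begin

text \<open>
  A continued fraction is given by its sequence of partial quotients
  \<open>a 0; a 1, a 2, \<dots>\<close>.
\<close>

primrec cf_convergent :: "nat \<Rightarrow> (nat \<Rightarrow> int) \<Rightarrow> real" where
  "cf_convergent 0 a = of_int (a 0)"
| "cf_convergent (Suc n) a = of_int (a 0) + 1 / cf_convergent n (\<lambda>i. a (Suc i))"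

text \<open>
  \<open>has_cf_value a x\<close> is the equation \<open>x = [a 0; a 1, a 2, \<dots>]\<close> for an infinite simple
  continued fraction. As a relation it asserts that the convergents do converge;
  positivity of the later partial quotients makes every division in
  \<open>cf_convergent\<close> a division by a positive number.
\<close>

definition has_cf_value :: "(nat \<Rightarrow> int) \<Rightarrow> real \<Rightarrow> bool" where
  "has_cf_value a x \<longleftrightarrow>
     (\<forall>i\<ge>1. a i > 0) \<and> (\<lambda>n. cf_convergent n a) \<longlonglongrightarrow> x"

definition periodic_cf :: "int \<Rightarrow> int list \<Rightarrow> nat \<Rightarrow> int" where
  "periodic_cf a0 as i = (if i = 0 then a0 else as ! ((i - 1) mod length as))"

text \<open>
  The denominators start at index \<open>-2\<close>, so the recursion runs over the index shifted by 2;
  values of \<open>cf_denom a j\<close> with \<open>j < -2\<close> are meaningless.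
\<close>

fun cf_denom_shifted :: "(nat \<Rightarrow> int) \<Rightarrow> nat \<Rightarrow> int" where
  "cf_denom_shifted a 0 = 1"
| "cf_denom_shifted a (Suc 0) = 0"
| "cf_denom_shifted a (Suc (Suc j)) = a j * cf_denom_shifted a (Suc j) + cf_denom_shifted a j"

definition cf_denom :: "(nat \<Rightarrow> int) \<Rightarrow> int \<Rightarrow> int" where
  "cf_denom a j = cf_denom_shifted a (nat (j + 2))"

end

theory Submission
  imports Defs
begin

text \<open>
  A purely periodic tail with block \<open>L\<close> is a positive fixed point of the map
  \<open>x \<mapsto> [L, x]\<close>, and conversely any positive fixed point \<open>x\<close> of this map is the
  value of the tail, since its complete quotients are the values \<open>[L', x]\<close> for the suffixes
  \<open>L'\<close> of \<open>L\<close> (\<open>has_cf_value_periodic\<close>). Both expansions thus reduce to checking that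
  \<open>x = 1 / (\<alpha> - a\<^sub>0)\<close> is a fixed point, where \<open>\<alpha>\<close> is the square root.

  For \<open>\<surd>(m\<^sup>2 + 2)\<close> this is immediate. For the long period, the block \<open>(m, 2m)\<close>
  repeated \<open>k\<close> times acts as the Moebius transformation with matrix
  \<open>(a, b; 2b, c)\<close>, where \<open>a = q\<^bsub>2k\<^esub>\<close>, \<open>b = q\<^bsub>2k-1\<^esub>\<close> and
  \<open>c = a - 2mb = q\<^bsub>2k-2\<^esub>\<close>, and the reversed block acts as its transpose
  (\<open>cf_prepend_blocks\<close>). Put \<open>A = an + m\<close>, \<open>\<delta> = \<alpha> - A\<close>, \<open>w = \<alpha> + A\<close>.
  Because \<open>2A + 1/x = w\<close>, the fixed point equation for \<open>x = 1/\<delta>\<close> says that the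
  palindromic word \<open>(m, 2m)\<^sup>k, A, (2m, m)\<^sup>k\<close> sends \<open>w\<close> to \<open>1/\<delta>\<close>. After clearing
  denominators, using \<open>w - \<delta> = 2A\<close> and cancelling \<open>aA + 2b\<close>, it collapses to
  \<open>a \<delta> w = 4bA + 2c\<close> (\<open>palindrome_moebius\<close>); as \<open>c = a - 2mb\<close>, the right side is \<open>2a(2bn + 1)\<close>, so the
  requirement is exactly \<open>\<alpha>\<^sup>2 - A\<^sup>2 = 2(2bn + 1)\<close>.
\<close>

section \<open>Periodic continued fractions as fixed points\<close>

lemma cf_convergent_ge_1:
  assumes "\<And>i. a i > 0"
  shows "cf_convergent n a \<ge> 1"
  using assms
proof (induction n arbitrary: a)
  case 0
  then show ?case using of_int_le_iff[of 1 "a 0"] by (simp add: int_one_le_iff_zero_less)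
next
  case (Suc n)
  have "cf_convergent n (\<lambda>i. a (Suc i)) \<ge> 1" by (rule Suc.IH) (simp add: Suc.prems)
  then have "1 / cf_convergent n (\<lambda>i. a (Suc i)) \<ge> 0" by simp
  moreover have "(of_int (a 0) :: real) \<ge> 1"
    using Suc.prems[of 0] by (simp add: int_one_le_iff_zero_less)
  ultimately show ?case unfolding cf_convergent.simps by linarith
qed

text \<open>
  One step gives only \<open>\<bar>1/c - 1/y\<bar> \<le> \<bar>c - y\<bar>\<close>, which need not contract. Two steps contract
  by a factor of at least \<open>4\<close>, because the product of two successive complete quotients is
  \<open>a\<^sub>1 y\<^sub>2 + 1 \<ge> 2\<close>, and likewise for two successive convergents.
\<close>

lemma cf_convergent_error:
  fixes y :: "nat \<Rightarrow> real"
  assumes "\<And>i. i \<ge> 1 \<Longrightarrow> a i > 0"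
    and "\<And>i. y i = of_int (a i) + 1 / y (Suc i)"
    and "\<And>i. i \<ge> 1 \<Longrightarrow> y i \<ge> 1"
  shows "\<bar>cf_convergent n a - y 0\<bar> \<le> 2 / 2 ^ n"
  using assms
proof (induction n arbitrary: a y rule: induct_nat_012)
  case 0
  have "y 1 \<ge> 1" "y 0 = of_int (a 0) + 1 / y 1" using 0(2)[of 0] 0(3)[of 1] by simp_all
  moreover from this(1) have "1 / y 1 \<ge> 0" "1 / y 1 \<le> 1" by simp_all
  ultimately show ?case unfolding cf_convergent.simps power_0 by linarith
next
  case 1
  have y1: "y 1 \<ge> 1" "y 0 = of_int (a 0) + 1 / y 1" using 1(2)[of 0] 1(3)[of 1] by simp_all
  have a1: "(of_int (a 1) :: real) \<ge> 1" using 1(1)[of 1] by (simp add: int_one_le_iff_zero_less)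
  have "1 / y 1 \<ge> 0" "1 / y 1 \<le> 1" "1 / of_int (a 1) \<ge> (0::real)"
    "1 / of_int (a 1) \<le> (1::real)"
    using y1 a1 by simp_all
  then have "\<bar>1 / of_int (a 1) - 1 / y 1\<bar> \<le> 1" by linarith
  then show ?case unfolding y1(2) by simp
next
  case (ge2 n)
  define c where "c = cf_convergent n (\<lambda>i. a (Suc (Suc i)))"
  define b where "b = (of_int (a 1) :: real)"
  have c: "c \<ge> 1" unfolding c_def by (rule cf_convergent_ge_1) (simp add: ge2.prems)
  have b: "b \<ge> 1" unfolding b_def using ge2.prems(1)[of 1] by (simp add: int_one_le_iff_zero_less)
  have y2: "y 2 \<ge> 1" using ge2.prems(3)[of 2] by simp
  have "\<bar>c - y (Suc (Suc 0))\<bar> \<le> 2 / 2 ^ n"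
    unfolding c_def
    by (rule ge2.IH(1)[of "\<lambda>i. a (Suc (Suc i))" "\<lambda>i. y (Suc (Suc i))"])
      (simp add: ge2.prems(1), rule ge2.prems(2), simp add: ge2.prems(3))
  then have IH: "\<bar>c - y 2\<bar> \<le> 2 / 2 ^ n" by (metis numeral_2_eq_2)
  have y0: "y 0 = of_int (a 0) + 1 / (b + 1 / y 2)"
    using ge2.prems(2)[of 0] ge2.prems(2)[of 1] unfolding b_def by (metis One_nat_def Suc_1)
  have inv: "1 / (b + 1 / t) = t / (b * t + 1)" if "t \<ge> 1" for t :: real
    using that by (simp add: field_simps)
  have ge: "b * t + 1 \<ge> 2" if "t \<ge> 1" for t :: real
    using mult_mono[of 1 b 1 t] that b by simp
  have "cf_convergent (Suc (Suc n)) a - y 0 = c / (b * c + 1) - y 2 / (b * y 2 + 1)"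
    unfolding y0 inv[OF y2, symmetric] inv[OF c, symmetric] by (simp add: c_def b_def)
  also have "\<dots> = (c - y 2) / ((b * c + 1) * (b * y 2 + 1))"
    using ge[OF c] ge[OF y2] by (simp add: field_simps)
  finally have "\<bar>cf_convergent (Suc (Suc n)) a - y 0\<bar>
      = \<bar>c - y 2\<bar> / ((b * c + 1) * (b * y 2 + 1))"
    using ge[OF c] ge[OF y2] by (simp add: abs_mult)
  also have "\<dots> \<le> (2 / 2 ^ n) / 4"
    using IH mult_mono[of 2 "b * c + 1" 2 "b * y 2 + 1"] ge[OF c] ge[OF y2]
    by (intro frac_le) auto
  finally show ?case by simp
qed

lemma has_cf_value_complete_quotients:
  fixes y :: "nat \<Rightarrow> real"
  assumes "\<And>i. i \<ge> 1 \<Longrightarrow> a i > 0"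
    and "\<And>i. y i = of_int (a i) + 1 / y (Suc i)"
    and "\<And>i. i \<ge> 1 \<Longrightarrow> y i \<ge> 1"
  shows "has_cf_value a (y 0)"
proof -
  have "(\<lambda>n. 2 * (1 / 2) ^ n :: real) \<longlonglongrightarrow> 2 * 0"
    by (intro tendsto_mult tendsto_const LIMSEQ_power_zero) simp
  then have "(\<lambda>n. 2 / 2 ^ n :: real) \<longlonglongrightarrow> 0"
    by (simp add: power_divide)
  then have "(\<lambda>n. cf_convergent n a - y 0) \<longlonglongrightarrow> 0"
    by (rule tendsto_0_le[where K = 1]) (use cf_convergent_error[of a y, OF assms] in simp)
  then show ?thesis
    using assms(1) unfolding has_cf_value_def by (simp add: LIM_zero_iff)
qed

definition cf_prepend :: "int list \<Rightarrow> real \<Rightarrow> real" where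
  "cf_prepend L x = foldr (\<lambda>a t. of_int a + 1 / t) L x"

lemma cf_prepend_simps [simp]:
  "cf_prepend [] x = x"
  "cf_prepend (a # L) x = of_int a + 1 / cf_prepend L x"
  "cf_prepend (L @ L') x = cf_prepend L (cf_prepend L' x)"
  by (simp_all add: cf_prepend_def)

lemma cf_prepend_pos:
  assumes "\<And>a. a \<in> set L \<Longrightarrow> a > 0" "x > 0"
  shows "cf_prepend L x > 0"
  using assms by (induction L) (auto intro: add_pos_pos)

lemma has_cf_value_periodic:
  assumes pos: "\<And>a. a \<in> set L \<Longrightarrow> a > 0" and ne: "L \<noteq> []" and x: "x > 0"
    and fixpoint: "cf_prepend L x = x"
  shows "has_cf_value (periodic_cf a0 L) (of_int a0 + 1 / x)"
proof -
  define l where "l = length L"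
  have l: "l > 0" using ne by (simp add: l_def)
  define y where "y i = (if i = 0 then of_int a0 + 1 / x
    else cf_prepend (drop ((i - 1) mod l) L) x)" for i
  have y_pos: "y (Suc i) > 0" for i
    unfolding y_def using pos x by (auto intro!: cf_prepend_pos dest: in_set_dropD)
  have quotient: "y (Suc i) = of_int (L ! (i mod l)) + 1 / y (Suc (Suc i))" for i
  proof -
    have lt: "i mod l < length L" using l by (simp add: l_def)
    have "y (Suc i) = of_int (L ! (i mod l)) + 1 / cf_prepend (drop (Suc (i mod l)) L) x"
      unfolding y_def using Cons_nth_drop_Suc[OF lt] by (metis cf_prepend_simps(2) diff_Suc_1 nat.distinct(1))
    \<comment> \<open>At the end of the period the empty suffix leaves \<open>x\<close>, which is \<open>[L, x]\<close> again.\<close>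
    moreover have "cf_prepend (drop (Suc (i mod l)) L) x = y (Suc (Suc i))"
      using fixpoint by (simp add: y_def mod_Suc) (simp add: l_def)
    ultimately show ?thesis by simp
  qed
  have y: "y i = of_int (periodic_cf a0 L i) + 1 / y (Suc i)" for i
  proof (cases i)
    case 0
    have "y (Suc 0) = x" using fixpoint by (simp add: y_def)
    then show ?thesis using 0 by (simp add: periodic_cf_def) (simp add: y_def)
  next
    case (Suc j)
    then show ?thesis using quotient[of j] by (simp add: periodic_cf_def l_def)
  qed
  have cf_pos: "periodic_cf a0 L i > 0" if "i \<ge> 1" for i
    using that pos ne by (simp add: periodic_cf_def)
  have "y i \<ge> 1" if "i \<ge> 1" for i
  proof -
    have "(of_int (periodic_cf a0 L i) :: real) \<ge> 1"
      using cf_pos[OF that] by (simp add: int_one_le_iff_zero_less)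
    moreover have "1 / y (Suc i) > 0" using y_pos[of i] by simp
    ultimately show ?thesis using y[of i] by linarith
  qed
  then have "has_cf_value (periodic_cf a0 L) (y 0)"
    by (intro has_cf_value_complete_quotients cf_pos y)
  then show ?thesis by (simp add: y_def)
qed

section \<open>The denominators and the action of the blocks\<close>

text \<open>
  The first partial quotient \<open>m\<close> is not \<open>2m\<close>, as periodicity would suggest, but it enters
  the denominators only through \<open>a\<^sub>0 q\<^bsub>-1\<^esub> = 0\<close>; so the two alternating recurrences hold
  from the start.
\<close>

lemma cf_denom_alternating:
  fixes m :: int
  defines "q \<equiv> cf_denom (periodic_cf m [m, 2 * m])"
  shows "q (2 * int 0) = 1" "q (2 * int 0 - 1) = 0"
    "q (2 * int (Suc k) - 1) = m * q (2 * int k) + q (2 * int k - 1)"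
    "q (2 * int (Suc k)) = 2 * m * q (2 * int (Suc k) - 1) + q (2 * int k)"
proof -
  let ?s = "cf_denom_shifted (periodic_cf m [m, 2 * m])"
  have even: "q (2 * int k) = ?s (2 * k + 2)" for k
    by (simp add: q_def cf_denom_def nat_add_distrib nat_mult_distrib)
  have odd: "q (2 * int k - 1) = ?s (2 * k + 1)" for k
  proof -
    have "nat (2 * int k - 1 + 2) = 2 * k + 1" by simp
    then show ?thesis by (simp add: q_def cf_denom_def)
  qed
  have length: "length [m, 2 * m] = 2" by simp
  have quotients: "periodic_cf m [m, 2 * m] (2 * k + 1) = m"
    "periodic_cf m [m, 2 * m] (2 * k + 2) = 2 * m"
    unfolding periodic_cf_def length by simp_all
  show "q (2 * int 0) = 1" "q (2 * int 0 - 1) = 0"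
    unfolding even odd by (simp_all add: numeral_2_eq_2)
  have "?s (2 * Suc k + 1) = periodic_cf m [m, 2 * m] (2 * k + 1) * ?s (2 * k + 2) + ?s (2 * k + 1)"
    using cf_denom_shifted.simps(3)[of "periodic_cf m [m, 2 * m]" "2 * k + 1"] by simp
  then show "q (2 * int (Suc k) - 1) = m * q (2 * int k) + q (2 * int k - 1)"
    unfolding even odd quotients by simp
  have "?s (2 * Suc k + 2) = periodic_cf m [m, 2 * m] (2 * k + 2) * ?s (2 * Suc k + 1) + ?s (2 * k + 2)"
    using cf_denom_shifted.simps(3)[of "periodic_cf m [m, 2 * m]" "2 * k + 2"] by simp
  then show "q (2 * int (Suc k)) = 2 * m * q (2 * int (Suc k) - 1) + q (2 * int k)"
    unfolding even odd quotients by simp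
qed

lemma alternating_bounds:
  fixes e d :: "nat \<Rightarrow> int"
  assumes m: "m \<ge> 1" and "e 0 = 1" "d 0 = 0"
    and d: "\<And>k. d (Suc k) = m * e k + d k"
    and e: "\<And>k. e (Suc k) = 2 * m * d (Suc k) + e k"
  shows "e k > 0" "d k \<ge> 0" "e k - 2 * m * d k > 0"
proof -
  have pos: "e k > 0 \<and> d k \<ge> 0" for k
    using assms by (induction k) (auto intro!: add_nonneg_pos)
  then show "e k > 0" "d k \<ge> 0" by auto
  show "e k - 2 * m * d k > 0"
    using pos[of "k - 1"] assms(2,3) e[of "k - 1"] by (cases k) auto
qed

text \<open>
  The matrix \<open>(2m\<^sup>2 + 1, m; 2m, 1)\<close> of the block \<open>(m, 2m)\<close> has lower left entry twice the
  upper right one, and diagonal entries differing by \<open>2m\<close> times the upper right one. Its powers are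
  linear combinations of it and the identity, so they share both properties and only
  \<open>e k\<close> and \<open>d k\<close> remain to be known.
\<close>

lemma cf_prepend_blocks:
  fixes e d :: "nat \<Rightarrow> int" and m :: int and y :: real
  assumes m: "m \<ge> 1" and e0: "e 0 = 1" and d0: "d 0 = 0"
    and d: "\<And>k. d (Suc k) = m * e k + d k"
    and e: "\<And>k. e (Suc k) = 2 * m * d (Suc k) + e k"
    and y: "y > 0"
  shows "cf_prepend (concat (replicate k [m, 2 * m])) y
      = (of_int (e k) * y + of_int (d k)) / (2 * of_int (d k) * y + of_int (e k - 2 * m * d k))"
    and "cf_prepend (concat (replicate k [2 * m, m])) y
      = (of_int (e k) * y + 2 * of_int (d k)) / (of_int (d k) * y + of_int (e k - 2 * m * d k))"
proof -
  define r where "r = (of_int m :: real)"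
  have r: "r > 0" using m by (simp add: r_def)
  have bounds: "(of_int (e k) :: real) > 0" "(of_int (d k) :: real) \<ge> 0"
    "(of_int (e k - 2 * m * d k) :: real) > 0" for k
    using alternating_bounds[of m e d k, OF m e0 d0 d e] unfolding of_int_0_less_iff of_int_0_le_iff by auto
  have step: "r + 1 / (2 * r + v / u) = ((2 * r\<^sup>2 + 1) * u + r * v) / (2 * r * u + v)"
    "2 * r + 1 / (r + v / u) = ((2 * r\<^sup>2 + 1) * u + 2 * r * v) / (r * u + v)"
    if "u > 0" "v > 0" for u v :: real
  proof -
    have "2 * r * u + v > 0" "r * u + v > 0" using that r by (simp_all add: add_pos_pos)
    then show "r + 1 / (2 * r + v / u) = ((2 * r\<^sup>2 + 1) * u + r * v) / (2 * r * u + v)"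
      "2 * r + 1 / (r + v / u) = ((2 * r\<^sup>2 + 1) * u + 2 * r * v) / (r * u + v)"
      using that by (simp_all add: divide_simps power2_eq_square) (simp_all add: algebra_simps)
  qed
  show "cf_prepend (concat (replicate k [m, 2 * m])) y
      = (of_int (e k) * y + of_int (d k)) / (2 * of_int (d k) * y + of_int (e k - 2 * m * d k))"
  proof (induction k)
    case 0
    then show ?case by (simp add: e0 d0)
  next
    case (Suc k)
    have "of_int (e k) * y + of_int (d k) > 0"
      "2 * of_int (d k) * y + of_int (e k - 2 * m * d k) > 0"
      using bounds[of k] y by (simp_all add: add_pos_nonneg add_nonneg_pos del: of_int_diff)
    note step = step(1)[OF this]
    have "cf_prepend (concat (replicate (Suc k) [m, 2 * m])) y
        = r + 1 / (2 * r + (2 * of_int (d k) * y + of_int (e k - 2 * m * d k))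
            / (of_int (e k) * y + of_int (d k)))"
      using Suc by (simp add: r_def)
    also note step
    finally show ?case
      unfolding e d by (simp add: r_def algebra_simps power2_eq_square)
  qed
  show "cf_prepend (concat (replicate k [2 * m, m])) y
      = (of_int (e k) * y + 2 * of_int (d k)) / (of_int (d k) * y + of_int (e k - 2 * m * d k))"
  proof (induction k)
    case 0
    then show ?case by (simp add: e0 d0)
  next
    case (Suc k)
    have "of_int (e k) * y + 2 * of_int (d k) > 0"
      "of_int (d k) * y + of_int (e k - 2 * m * d k) > 0"
      using bounds[of k] y by (simp_all add: add_pos_nonneg add_nonneg_pos del: of_int_diff)
    note step = step(2)[OF this]
    have "cf_prepend (concat (replicate (Suc k) [2 * m, m])) y
        = 2 * r + 1 / (r + (of_int (d k) * y + of_int (e k - 2 * m * d k))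
            / (of_int (e k) * y + 2 * of_int (d k)))"
      using Suc by (simp add: r_def)
    also note step
    finally show ?case
      unfolding e d by (simp add: r_def algebra_simps power2_eq_square)
  qed
qed

section \<open>The fixed point equation of the palindromic word\<close>

text \<open>
  The maps with matrices \<open>(a, b; 2b, c)\<close>, \<open>(A, 1; 1, 0)\<close> and \<open>(a, 2b; b, c)\<close> are composed.
  The symmetry of the word makes the terms \<open>acw\<close> and \<open>2b\<^sup>2w\<close> on one side match
  \<open>ac\<delta>\<close> and \<open>2b\<^sup>2\<delta>\<close> on the other, so the equation involves \<open>w\<close> and \<open>\<delta>\<close> only through
  \<open>w - \<delta>\<close> and \<open>w\<delta>\<close>.
\<close>

lemma palindrome_moebius:
  fixes a b c A w \<delta> :: real
  assumes pos: "a > 0" "b \<ge> 0" "c > 0" "A > 0" "w > 0" "\<delta> > 0"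
    and diff: "w - \<delta> = 2 * A" and prod: "a * (w * \<delta>) = 4 * b * A + 2 * c"
  defines "u \<equiv> A + 1 / ((a * w + 2 * b) / (b * w + c))"
  shows "(a * u + b) / (2 * b * u + c) = 1 / \<delta>"
proof -
  define h where "h = a * w + 2 * b"
  have h: "h > 0" unfolding h_def using pos by (intro add_pos_nonneg) auto
  have u_h: "u * h = A * h + b * w + c"
    using h unfolding u_def h_def[symmetric] by (simp add: distrib_right[of A])
  have "u > 0" unfolding u_def using pos by (intro add_pos_nonneg) auto
  then have den: "2 * b * u + c > 0" using pos by (intro add_nonneg_pos) auto
  have w: "w = \<delta> + 2 * A" using diff by simp
  \<comment> \<open>The condition on \<open>w\<delta>\<close> appears as a factor; the other one is \<open>aA + 2b\<close>.\<close>
  have "\<delta> * (a * (u * h) + b * h) - (2 * b * (u * h) + c * h)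
      = (a * (w * \<delta>) - (4 * b * A + 2 * c)) * (a * A + 2 * b)"
    unfolding u_h unfolding h_def w by algebra
  then have "(\<delta> * (a * u + b)) * h = (2 * b * u + c) * h"
    unfolding prod by (simp add: algebra_simps)
  then have "\<delta> * (a * u + b) = 2 * b * u + c" using h by simp
  then show ?thesis using den pos by (simp add: field_simps)
qed

theorem mainTheorem3:
  fixes m M :: int and q :: "int \<Rightarrow> int"
  assumes "m \<ge> 1"
    and "q = cf_denom (periodic_cf m [m, 2 * m])"
    and "M = 2 * (m^2 + 1)"
  shows "has_cf_value (periodic_cf m [m, 2 * m]) (sqrt (of_int (m^2 + 2)))
    \<and> q (-1) = 0 \<and> q 0 = 1 \<and> q 1 = m
    \<and> (\<forall>k::int. k \<ge> 1 \<longrightarrow>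
          q (2 * k + 2) = M * q (2 * k) - q (2 * k - 2)
        \<and> q (2 * k + 1) = M * q (2 * k - 1) - q (2 * k - 3))
    \<and> q 2 = 2 * m^2 + 1
    \<and> q 3 = 2 * m * (m^2 + 1)
    \<and> q 4 = 2 * m^2 * (2 * m^2 + 3) + 1
    \<and> (\<forall>(k::nat) (n::int). k \<ge> 1 \<longrightarrow> n \<ge> 1 \<longrightarrow>
          has_cf_value
            (periodic_cf (q (2 * int k) * n + m)
               (concat (replicate k [m, 2 * m])
                @ [q (2 * int k) * n + m]
                @ concat (replicate k [2 * m, m])
                @ [2 * (q (2 * int k) * n + m)]))
            (sqrt (of_int ((q (2 * int k) * n + m)^2 + 2 * (2 * q (2 * int k - 1) * n + 1)))))"
proof -
  define e where "e k = q (2 * int k)" for k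
  define d where "d k = q (2 * int k - 1)" for k
  note alternating = cf_denom_alternating[of m, folded assms(2), folded e_def d_def]
  have e0: "e 0 = 1" and d0: "d 0 = 0"
    and d: "d (Suc k) = m * e k + d k"
    and e: "e (Suc k) = 2 * m * d (Suc k) + e k" for k
    using alternating by auto

  have "has_cf_value (periodic_cf m [m, 2 * m]) (sqrt (of_int (m^2 + 2)))"
  proof -
    define s where "s = sqrt (of_int (m^2 + 2))"
    have m: "(of_int m :: real) \<ge> 1" using assms(1) by simp
    have s2: "s * s = of_int m * of_int m + 2"
      unfolding s_def by (simp add: power2_eq_square)
    have "s > of_int m" unfolding s_def by (rule real_less_rsqrt) simp
    then have pos: "s + of_int m > 0" using m by simp
    \<comment> \<open>As \<open>s\<^sup>2 - m\<^sup>2 = 2\<close>, the complete quotient \<open>1 / (s - m)\<close> is \<open>(s + m) / 2\<close>.\<close>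
    define x where "x = (s + of_int m) / 2"
    have inv: "1 / x = s - of_int m" using pos s2 by (simp add: x_def field_simps)
    have "of_int m + 1 / (s + of_int m) = x"
      using pos s2 by (simp add: x_def field_simps)
    then have "cf_prepend [m, 2 * m] x = x" by (simp add: inv algebra_simps)
    moreover have "x > 0" using pos by (simp add: x_def)
    ultimately have "has_cf_value (periodic_cf m [m, 2 * m]) (of_int m + 1 / x)"
      using assms(1) by (intro has_cf_value_periodic) auto
    then show ?thesis by (simp add: inv s_def)
  qed
  moreover have "q (-1) = 0" "q 0 = 1" using e0 d0 by (simp_all add: e_def d_def)
  moreover have "q (2 * k + 2) = M * q (2 * k) - q (2 * k - 2)"
    "q (2 * k + 1) = M * q (2 * k - 1) - q (2 * k - 3)" if "k \<ge> 1" for k :: int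
  proof -
    define j where "j = nat (k - 1)"
    have k: "k = int j + 1" using that by (simp add: j_def)
    have "e (Suc (Suc j)) = M * e (Suc j) - e j" "d (Suc (Suc j)) = M * d (Suc j) - d j"
      unfolding e d assms(3) by algebra+
    then show "q (2 * k + 2) = M * q (2 * k) - q (2 * k - 2)"
      "q (2 * k + 1) = M * q (2 * k - 1) - q (2 * k - 3)"
      by (simp_all add: e_def d_def k algebra_simps)
  qed
  moreover have "q 1 = m" "q 2 = 2 * m^2 + 1" "q 3 = 2 * m * (m^2 + 1)"
    "q 4 = 2 * m^2 * (2 * m^2 + 3) + 1"
  proof -
    have "d (Suc 0) = m" "e (Suc 0) = 2 * m^2 + 1" "d (Suc (Suc 0)) = 2 * m * (m^2 + 1)"
      "e (Suc (Suc 0)) = 2 * m^2 * (2 * m^2 + 3) + 1"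
      unfolding e d e0 d0 by (simp_all add: algebra_simps power2_eq_square)
    then show "q 1 = m" "q 2 = 2 * m^2 + 1" "q 3 = 2 * m * (m^2 + 1)"
      "q 4 = 2 * m^2 * (2 * m^2 + 3) + 1"
      by (simp_all add: e_def d_def)
  qed
  moreover have "has_cf_value
      (periodic_cf (e k * n + m)
        (concat (replicate k [m, 2 * m]) @ [e k * n + m]
          @ concat (replicate k [2 * m, m]) @ [2 * (e k * n + m)]))
      (sqrt (of_int ((e k * n + m)^2 + 2 * (2 * d k * n + 1))))"
    if n: "n \<ge> 1" for k :: nat and n :: int
  proof -
    define A where "A = e k * n + m"
    define \<alpha> where "\<alpha> = sqrt (of_int (A^2 + 2 * (2 * d k * n + 1)))"
    define w where "w = \<alpha> + of_int A"
    define \<delta> where "\<delta> = \<alpha> - of_int A"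
    define c where "c = e k - 2 * m * d k"
    have bounds: "e k > 0" "d k \<ge> 0" "c > 0"
      unfolding c_def using alternating_bounds[of m e d k, OF assms(1) e0 d0 d e] by auto
    have A: "A > 0" unfolding A_def using bounds n assms(1) by (intro add_pos_pos) auto
    have dn: "d k * n \<ge> 0" using bounds n by simp
    have "A^2 < A^2 + 2 * (2 * d k * n + 1)" using dn by (simp add: mult.assoc)
    then have "of_int A < \<alpha>"
      unfolding \<alpha>_def by (intro real_less_rsqrt) (simp only: of_int_less_iff flip: of_int_power)
    then have \<delta>: "\<delta> > 0" and w: "w > 0" using A by (simp_all add: \<delta>_def w_def)
    have "of_int (A^2 + 2 * (2 * d k * n + 1)) \<ge> (0 :: real)"
      unfolding of_int_0_le_iff using dn by (simp add: mult.assoc)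
    then have \<alpha>2: "\<alpha>\<^sup>2 = of_int (A^2 + 2 * (2 * d k * n + 1))"
      unfolding \<alpha>_def by simp
    have "w * \<delta> = \<alpha>\<^sup>2 - (of_int A)\<^sup>2"
      by (simp add: w_def \<delta>_def algebra_simps power2_eq_square)
    also have "\<dots> = of_int (2 * (2 * d k * n + 1))" unfolding \<alpha>2 by simp
    finally have "of_int (e k) * (w * \<delta>) = of_int (e k * (2 * (2 * d k * n + 1)))"
      by simp
    also have "e k * (2 * (2 * d k * n + 1)) = 4 * d k * A + 2 * c"
      unfolding A_def c_def by algebra
    finally have prod: "of_int (e k) * (w * \<delta>) = 4 * of_int (d k) * of_int A + 2 * of_int c"
      by simp
    define u where "u = of_int A + 1 / ((of_int (e k) * w + 2 * of_int (d k))
        / (of_int (d k) * w + of_int c))"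
    have u: "u > 0" unfolding u_def using bounds A w by (intro add_pos_nonneg) auto
    let ?L = "concat (replicate k [m, 2 * m]) @ [A] @ concat (replicate k [2 * m, m]) @ [2 * A]"
    have "cf_prepend ?L (1 / \<delta>)
        = cf_prepend (concat (replicate k [m, 2 * m]))
            (of_int A + 1 / cf_prepend (concat (replicate k [2 * m, m])) w)"
      by (simp add: w_def \<delta>_def algebra_simps)
    also have "\<dots> = cf_prepend (concat (replicate k [m, 2 * m])) u"
      unfolding cf_prepend_blocks(2)[of m e d, OF assms(1) e0 d0 d e w] u_def c_def ..
    also have "\<dots> = (of_int (e k) * u + of_int (d k)) / (2 * of_int (d k) * u + of_int c)"
      unfolding cf_prepend_blocks(1)[of m e d, OF assms(1) e0 d0 d e u] c_def ..
    also have "\<dots> = 1 / \<delta>"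
      unfolding u_def using bounds A w \<delta> prod
      by (intro palindrome_moebius) (simp_all add: w_def \<delta>_def)
    finally have fixpoint: "cf_prepend ?L (1 / \<delta>) = 1 / \<delta>" .
    have "has_cf_value (periodic_cf A ?L) (of_int A + 1 / (1 / \<delta>))"
      by (rule has_cf_value_periodic[OF _ _ _ fixpoint])
        (use assms(1) A \<delta> in \<open>auto split: if_splits\<close>)
    then show ?thesis by (simp add: \<delta>_def \<alpha>_def A_def)
  qed
  ultimately show ?thesis unfolding e_def d_def by blast
qed

end
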